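(* Let $k$ be a field, $m$ a positive integer and $G$ a group. The isomorphism types of good $G$-gradings of the matrix algebra $\mathrm{M}_m(k)$ are classified by the orbits of the biaction of the symmetric group $\mathcal{S}_m$ (from the left, by permuting the entries) and $G$ (from the right, by translation) on the set $G^m$. That is, associating to $(g_1,\ldots,g_m)\in G^m$ the good grading of $\mathrm{M}_m(k)$ in which $e_{ij}$ has degree $g_ig_j^{-1}$ (i.e. the grading $\mathrm{END}(V)$, where $V$ is the $G$-graded vector space having a homogeneous basis with degrees $g_1,\ldots,g_m$) induces a bijection between the set of these orbits and the set of isomorphism classes of good $G$-gradings of $\mathrm{M}_m(k)$. Here $(g_1,\ldots,g_m)$ and $(h_1,\ldots,h_m)$ are in the same orbit if and only if there exist $\sigma\in G$ and a permutation $\pi$ of $\{1,\ldots,m\}$ such that $h_i=g_{\pi(i)}\sigma$ for all $1\le i\le m$.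
   Context: A $G$-grading of a $k$-algebra $A$ is a decomposition $A=\bigoplus_{g\in G}A_g$ into subspaces with $A_gA_h\subseteq A_{gh}$ for all $g,h\in G$. Two gradings are isomorphic if there is an algebra isomorphism mapping each degree-$g$ component onto the degree-$g$ component. A $G$-grading of $\mathrm{M}_m(k)$ is called good if all the matrix units $e_{ij}$ are homogeneous elements. For a finite dimensional $G$-graded vector space $V=\bigoplus_{g}V_g$, $\mathrm{END}(V)$ denotes $\mathrm{End}_k(V)$ with the $G$-grading $\mathrm{END}(V)_\sigma=\{f\in\mathrm{End}_k(V)\mid f(V_g)\subseteq V_{\sigma g}\text{ for all }g\in G\}$. *)

theory Defs
  imports "HOL-Analysis.Analysis" "HOL-Algebra.Group"
begin

text \<open>
  Conventions. The index set of the matrices is a finite type \<open>'m\<close>, with \<open>CARD('m)\<close> in the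
  role of \<open>m\<close>; thus \<open>M\<^sub>m(k)\<close> is the type \<open>'k^'m^'m\<close>, with \<open>A $ i $ j\<close> the entry in row
  \<open>i\<close> and column \<open>j\<close> and with product \<open>**\<close>. The grading group \<open>G\<close> is an arbitrary
  (multiplicative, not necessarily commutative or finite) group with explicit carrier.
\<close>

definition mat_scale :: "'k::field \<Rightarrow> 'k^'m^'m \<Rightarrow> 'k^'m^'m" where
  "mat_scale c A = (\<chi> i j. c * A $ i $ j)"

interpretation mat: vector_space "mat_scale :: 'k::field \<Rightarrow> 'k^'m^'m \<Rightarrow> 'k^'m^'m"
  by unfold_locales (simp_all add: mat_scale_def vec_eq_iff algebra_simps)

definition matrix_unit :: "'m \<Rightarrow> 'm \<Rightarrow> 'k::field^'m^'m" where
  "matrix_unit i j = (\<chi> a b. if a = i \<and> b = j then 1 else 0)"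

text \<open>
  The family \<open>V\<close> of components is undefined outside \<open>carrier G\<close>, so that equality of
  gradings is equality of all components. The family \<open>c\<close> below is the family of homogeneous
  components of \<open>v\<close>: existence and uniqueness express that the space is the (internal) direct
  sum of the subspaces \<open>V g\<close>. The group may be infinite, hence the finite support.
\<close>

definition graded_space ::
  "('g, 'x) monoid_scheme \<Rightarrow> ('k::field \<Rightarrow> 'v::ab_group_add \<Rightarrow> 'v) \<Rightarrow> ('g \<Rightarrow> 'v set) \<Rightarrow> bool" where
  "graded_space G scl V \<longleftrightarrow>
     V \<in> carrier G \<rightarrow>\<^sub>E {U. module.subspace scl U} \<and>
     (\<forall>v. \<exists>!c. (\<forall>g\<in>carrier G. c g \<in> V g) \<and> (\<forall>g. g \<notin> carrier G \<longrightarrow> c g = 0) \<and>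
              finite {g. c g \<noteq> 0} \<and> v = (\<Sum>g | c g \<noteq> 0. c g))"

definition matrix_grading ::
  "('g, 'x) monoid_scheme \<Rightarrow> ('g \<Rightarrow> ('k::field^'m^'m) set) \<Rightarrow> bool" where
  "matrix_grading G \<A> \<longleftrightarrow>
     graded_space G mat_scale \<A> \<and>
     (\<forall>g\<in>carrier G. \<forall>h\<in>carrier G. \<forall>A\<in>\<A> g. \<forall>B\<in>\<A> h. A ** B \<in> \<A> (g \<otimes>\<^bsub>G\<^esub> h))"

definition good_gradings ::
  "('g, 'x) monoid_scheme \<Rightarrow> ('g \<Rightarrow> ('k::field^'m^'m) set) set" where
  "good_gradings G =
     {\<A>. matrix_grading G \<A> \<and> (\<forall>i j. \<exists>g\<in>carrier G. matrix_unit i j \<in> \<A> g)}"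

definition matrix_algebra_iso :: "('k::field^'m^'m \<Rightarrow> 'k^'m^'m) \<Rightarrow> bool" where
  "matrix_algebra_iso \<phi> \<longleftrightarrow>
     Vector_Spaces.linear mat_scale mat_scale \<phi> \<and> bij \<phi> \<and>
     \<phi> (mat 1) = mat 1 \<and> (\<forall>A B. \<phi> (A ** B) = \<phi> A ** \<phi> B)"

definition good_grading_iso ::
  "('g, 'x) monoid_scheme \<Rightarrow> (('g \<Rightarrow> ('k::field^'m^'m) set) \<times> ('g \<Rightarrow> ('k^'m^'m) set)) set" where
  "good_grading_iso G =
     {(\<A>, \<B>). \<A> \<in> good_gradings G \<and> \<B> \<in> good_gradings G \<and>
        (\<exists>\<phi>. matrix_algebra_iso \<phi> \<and> (\<forall>g\<in>carrier G. \<phi> ` \<A> g = \<B> g))}"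

text \<open>\<open>End(k\<^sup>m)\<close> is identified with \<open>M\<^sub>m(k)\<close> through the standard basis, \<open>A\<close> acting as
  \<open>v \<mapsto> A *v v\<close>.\<close>

definition END ::
  "('g, 'x) monoid_scheme \<Rightarrow> ('g \<Rightarrow> ('k::field^'m) set) \<Rightarrow> 'g \<Rightarrow> ('k^'m^'m) set" where
  "END G V =
     (\<lambda>\<sigma>\<in>carrier G. {A. \<forall>g\<in>carrier G. (\<lambda>v. A *v v) ` V g \<subseteq> V (\<sigma> \<otimes>\<^bsub>G\<^esub> g)})"

text \<open>The space \<open>k\<^sup>m\<close> graded so that the \<open>i\<close>-th standard basis vector has degree \<open>g i\<close>.\<close>

definition tuple_space ::
  "('g, 'x) monoid_scheme \<Rightarrow> ('m \<Rightarrow> 'g) \<Rightarrow> 'g \<Rightarrow> ('k::field^'m) set" where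
  "tuple_space G g = (\<lambda>\<sigma>\<in>carrier G. vec.span {axis i 1 | i. g i = \<sigma>})"

definition tuple_grading ::
  "('g, 'x) monoid_scheme \<Rightarrow> ('m \<Rightarrow> 'g) \<Rightarrow> 'g \<Rightarrow> ('k::field^'m^'m) set" where
  "tuple_grading G g = END G (tuple_space G g)"

definition tuples :: "('g, 'x) monoid_scheme \<Rightarrow> ('m::finite \<Rightarrow> 'g) set" where
  "tuples G = UNIV \<rightarrow> carrier G"

text \<open>With the inverse, this is a left action of the symmetric group on tuples.\<close>

definition permute_entries :: "('m \<Rightarrow> 'm) \<Rightarrow> ('m \<Rightarrow> 'g) \<Rightarrow> 'm \<Rightarrow> 'g" where
  "permute_entries \<pi> g = g \<circ> inv_into UNIV \<pi>"

definition translate :: "('g, 'x) monoid_scheme \<Rightarrow> ('m \<Rightarrow> 'g) \<Rightarrow> 'g \<Rightarrow> 'm \<Rightarrow> 'g" where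
  "translate G g \<sigma> = (\<lambda>i. g i \<otimes>\<^bsub>G\<^esub> \<sigma>)"

definition tuple_orbit ::
  "('g, 'x) monoid_scheme \<Rightarrow> ('m::finite \<Rightarrow> 'g) \<Rightarrow> ('m \<Rightarrow> 'g) set" where
  "tuple_orbit G g =
     {translate G (permute_entries \<pi> g) \<sigma> | \<pi> \<sigma>. \<pi> permutes UNIV \<and> \<sigma> \<in> carrier G}"

end

theory Submission
  imports Defs
begin

text \<open>
  In coordinates, the component of degree \<open>\<sigma>\<close> of the grading attached to a tuple \<open>g\<close> consists
  of the matrices \<open>A\<close> whose nonzero entries \<open>A $ i $ j\<close> sit at positions with
  \<open>g\<^sub>i g\<^sub>j\<^sup>-\<^sup>1 = \<sigma>\<close> (\<open>mem_tuple_grading_iff\<close>). A good grading is determined by the degrees \<open>d\<^sub>i\<^sub>j\<close>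
  of the matrix units, and \<open>e\<^sub>i\<^sub>j e\<^sub>j\<^sub>l = e\<^sub>i\<^sub>l \<noteq> 0\<close> forces \<open>d\<^sub>i\<^sub>j d\<^sub>j\<^sub>l = d\<^sub>i\<^sub>l\<close>. Such a cocycle is a coboundary:
  \<open>d\<^sub>i\<^sub>j = g\<^sub>i g\<^sub>j\<^sup>-\<^sup>1\<close> with \<open>g\<^sub>i = d\<^sub>i\<^sub>r\<close> for any fixed index \<open>r\<close>. Hence tuples yield all good gradings
  (\<open>good_grading_is_tuple_grading\<close>).

  Translating a tuple on the right does not change the products \<open>g\<^sub>i g\<^sub>j\<^sup>-\<^sup>1\<close>, and permuting its
  entries amounts to conjugating by a permutation matrix; so tuples in one orbit give isomorphic
  gradings (\<open>permuted_translated_imp_iso\<close>).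

  The converse is the heart of the matter (\<open>tuple_grading_hom_imp_permuted\<close>). Let \<open>\<phi>\<close> be an
  isomorphism from the grading of \<open>g\<close> to that of \<open>h\<close>. One could write \<open>\<phi>\<close> as a conjugation by
  the Skolem-Noether theorem and use uniqueness of the graded simple module, but a direct argument
  suffices. The matrices \<open>f\<^sub>i\<^sub>j = \<phi> e\<^sub>i\<^sub>j\<close> multiply like matrix units, and \<open>f\<^sub>i\<^sub>j\<close> has degree
  \<open>g\<^sub>i g\<^sub>j\<^sup>-\<^sup>1\<close> in the grading of \<open>h\<close>. Choose a standard basis vector \<open>v\<close> with \<open>f\<^sub>r\<^sub>r v \<noteq> 0\<close>. The vectors
  \<open>w\<^sub>i = f\<^sub>i\<^sub>r v\<close> are linearly independent, and \<open>w\<^sub>i\<close> is homogeneous of degree \<open>g\<^sub>i \<rho>\<close>, where \<open>\<rho>\<close>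
  does not depend on \<open>i\<close>. The matrix with columns \<open>w\<^sub>i\<close> therefore has nonzero determinant, so some term
  of the permutation expansion is nonzero: there is a permutation \<open>\<pi>\<close> such that \<open>w\<^bsub>\<pi> a\<^esub>\<close> has a
  nonzero entry at \<open>a\<close>, for every \<open>a\<close>. That entry has degree \<open>h\<^sub>a\<close>, whence
  \<open>h\<^sub>a = g\<^bsub>\<pi> a\<^esub> \<rho>\<close>.

  Isomorphism of good gradings is thus equality of orbits of the tuples that define them
  (\<open>tuple_grading_iso_iff\<close>), and both the equivalence relation and the bijection follow.
\<close>

section \<open>Graded vector spaces\<close>

definition homogeneous_decomposition ::
  "('g, 'x) monoid_scheme \<Rightarrow> ('g \<Rightarrow> 'v::ab_group_add set) \<Rightarrow> 'v \<Rightarrow> ('g \<Rightarrow> 'v) \<Rightarrow> bool" where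
  "homogeneous_decomposition G V v c \<longleftrightarrow>
     (\<forall>g\<in>carrier G. c g \<in> V g) \<and> (\<forall>g. g \<notin> carrier G \<longrightarrow> c g = 0) \<and>
     finite {g. c g \<noteq> 0} \<and> v = (\<Sum>g | c g \<noteq> 0. c g)"

lemma graded_space_iff_decomposition:
  "graded_space G scl V \<longleftrightarrow>
     V \<in> carrier G \<rightarrow>\<^sub>E {U. module.subspace scl U} \<and> (\<forall>v. \<exists>!c. homogeneous_decomposition G V v c)"
  unfolding graded_space_def homogeneous_decomposition_def ..

lemma graded_space_subspace:
  assumes "graded_space G scl V" and "\<sigma> \<in> carrier G"
  shows "module.subspace scl (V \<sigma>)"
  using assms unfolding graded_space_def by (auto simp: PiE_iff)

lemma graded_space_decomposition_unique:
  assumes "graded_space G scl V"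
    and "homogeneous_decomposition G V v c" and "homogeneous_decomposition G V v d"
  shows "c = d"
  using assms unfolding graded_space_iff_decomposition by blast

lemma homogeneous_decomposition_single:
  assumes "module scl" and "graded_space G scl V" and "\<sigma> \<in> carrier G" and "v \<in> V \<sigma>"
  shows "homogeneous_decomposition G V v (\<lambda>\<tau>. if \<tau> = \<sigma> then v else 0)"
proof -
  have zero: "0 \<in> V \<tau>" if "\<tau> \<in> carrier G" for \<tau>
    using module.subspace_0[OF assms(1) graded_space_subspace[OF assms(2) that]] .
  have support: "{\<tau>. (if \<tau> = \<sigma> then v else 0) \<noteq> 0} = (if v = 0 then {} else {\<sigma>})"
    by auto
  show ?thesis
    unfolding homogeneous_decomposition_def support using assms zero by auto
qed

lemma graded_space_degree_unique:
  assumes "module scl" and "graded_space G scl V" and "\<sigma> \<in> carrier G" and "\<tau> \<in> carrier G"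
    and "v \<in> V \<sigma>" and "v \<in> V \<tau>" and "v \<noteq> 0"
  shows "\<sigma> = \<tau>"
proof -
  have "(\<lambda>\<rho>. if \<rho> = \<sigma> then v else 0) = (\<lambda>\<rho>. if \<rho> = \<tau> then v else 0)"
    using graded_space_decomposition_unique[OF assms(2)]
      homogeneous_decomposition_single[OF assms(1,2)] assms(3-6) by blast
  from fun_cong[OF this, of \<sigma>] show ?thesis
    using assms(7) by (simp split: if_splits)
qed

text \<open>
  Componentwise inclusion suffices for equality: a decomposition with respect to the smaller
  components is also one with respect to the larger components, where it is unique.
\<close>

lemma graded_space_eqI:
  assumes "module scl" and V: "graded_space G scl V" and W: "graded_space G scl W"
    and le: "\<And>\<sigma>. \<sigma> \<in> carrier G \<Longrightarrow> V \<sigma> \<subseteq> W \<sigma>"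
  shows "V = W"
proof (rule extensionalityI)
  show "V \<in> extensional (carrier G)" and "W \<in> extensional (carrier G)"
    using V W unfolding graded_space_def by (auto simp: PiE_iff)
  fix \<sigma> assume \<sigma>: "\<sigma> \<in> carrier G"
  have "w \<in> V \<sigma>" if w: "w \<in> W \<sigma>" for w
  proof -
    obtain c where c: "homogeneous_decomposition G V w c"
      using V unfolding graded_space_iff_decomposition by blast
    have "homogeneous_decomposition G W w c"
      using c le unfolding homogeneous_decomposition_def by blast
    then have "c = (\<lambda>\<tau>. if \<tau> = \<sigma> then w else 0)"
      using graded_space_decomposition_unique[OF W]
        homogeneous_decomposition_single[OF assms(1) W \<sigma> w] by blast
    then have "c \<sigma> = w" by simp
    then show ?thesis
      using c \<sigma> unfolding homogeneous_decomposition_def by blast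
  qed
  then show "V \<sigma> = W \<sigma>" using le[OF \<sigma>] by blast
qed

text \<open>
  A space with linear coordinates indexed by a finite type is graded by giving the \<open>i\<close>-th
  coordinate the degree \<open>d i\<close>; the component of \<open>v\<close> in degree \<open>\<sigma>\<close> keeps the coordinates of degree
  \<open>\<sigma>\<close> and erases the others. Both column vectors and matrices are graded in this way.
\<close>

lemma graded_space_by_coordinates:
  fixes scl :: "'k::field \<Rightarrow> 'v::ab_group_add \<Rightarrow> 'v" and coord :: "'i::finite \<Rightarrow> 'v \<Rightarrow> 'k"
  assumes "module scl"
    and add: "\<And>i v w. coord i (v + w) = coord i v + coord i w"
    and scale: "\<And>i a v. coord i (scl a v) = a * coord i v"
    and ext: "\<And>v w. (\<And>i. coord i v = coord i w) \<Longrightarrow> v = w"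
    and ex: "\<And>f. \<exists>v. \<forall>i. coord i v = f i"
    and deg: "\<And>i. d i \<in> carrier G"
    and V: "V = (\<lambda>\<sigma>\<in>carrier G. {v. \<forall>i. coord i v \<noteq> 0 \<longrightarrow> d i = \<sigma>})"
  shows "graded_space G scl V"
proof -
  have zero: "coord i 0 = 0" for i
    using add[of i 0 0] by (metis add.right_neutral add_left_cancel)
  have sum: "coord i (\<Sum>x\<in>X. f x) = (\<Sum>x\<in>X. coord i (f x))" for i X and f :: "'g \<Rightarrow> 'v"
    by (induction X rule: infinite_finite_induct) (simp_all add: zero add)
  have "module.subspace scl (V \<sigma>)" if "\<sigma> \<in> carrier G" for \<sigma>
    using that unfolding module.subspace_def[OF assms(1)] V
    by (auto simp: zero add scale)
      (metis add.left_neutral)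
  moreover have "\<exists>!c. homogeneous_decomposition G V v c" for v
  proof -
    define comp where "comp \<sigma> = (SOME w. \<forall>i. coord i w = (if d i = \<sigma> then coord i v else 0))" for \<sigma>
    have comp: "coord i (comp \<sigma>) = (if d i = \<sigma> then coord i v else 0)" for i \<sigma>
      using someI_ex[OF ex[of "\<lambda>i. if d i = \<sigma> then coord i v else 0"]]
      unfolding comp_def by blast
    have support: "{\<sigma>. comp \<sigma> \<noteq> 0} \<subseteq> range d"
    proof
      fix \<sigma> assume "\<sigma> \<in> {\<sigma>. comp \<sigma> \<noteq> 0}"
      then obtain i where "coord i (comp \<sigma>) \<noteq> 0"
        using ext[of "comp \<sigma>" 0] zero by auto
      then show "\<sigma> \<in> range d"
        by (auto simp: comp split: if_splits)
    qed
    then have fin: "finite {\<sigma>. comp \<sigma> \<noteq> 0}"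
      by (rule finite_subset) simp
    have "v = (\<Sum>\<sigma> | comp \<sigma> \<noteq> 0. comp \<sigma>)"
    proof (rule ext)
      fix i
      have "(\<Sum>\<sigma> | comp \<sigma> \<noteq> 0. coord i (comp \<sigma>)) = (\<Sum>\<sigma>\<in>range d. coord i (comp \<sigma>))"
        using support by (intro sum.mono_neutral_left) (auto simp: zero)
      also have "\<dots> = coord i v"
        by (simp add: comp)
      finally show "coord i v = coord i (\<Sum>\<sigma> | comp \<sigma> \<noteq> 0. comp \<sigma>)"
        by (simp add: sum)
    qed
    then have "homogeneous_decomposition G V v comp"
      using fin support deg unfolding homogeneous_decomposition_def V
      by (auto simp: comp)
    \<comment> \<open>For uniqueness, read off coordinate \<open>i\<close> of the sum: only the summand in degree \<open>d i\<close>
        contributes to it.\<close>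
    moreover have "c = comp" if c: "homogeneous_decomposition G V v c" for c
    proof (rule, rule ext)
      fix \<sigma> i
      have off: "coord i (c \<tau>) = 0" if "d i \<noteq> \<tau>" for \<tau>
        using c that zero unfolding homogeneous_decomposition_def V
        by (cases "\<tau> \<in> carrier G") auto
      have "coord i v = (\<Sum>\<tau> | c \<tau> \<noteq> 0. coord i (c \<tau>))"
        using c unfolding homogeneous_decomposition_def by (metis sum)
      also have "\<dots> = (\<Sum>\<tau> | c \<tau> \<noteq> 0. if \<tau> = d i then coord i (c (d i)) else 0)"
        using off by (intro sum.cong) auto
      also have "\<dots> = coord i (c (d i))"
        using c zero unfolding homogeneous_decomposition_def by (simp add: sum.delta)
      finally show "coord i (c \<sigma>) = coord i (comp \<sigma>)"
        using off by (simp add: comp)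
    qed
    ultimately show ?thesis by blast
  qed
  ultimately show ?thesis
    unfolding graded_space_iff_decomposition by (auto simp: V)
qed

section \<open>Gradings given by tuples\<close>

lemma mem_tuple_space_iff:
  fixes v :: "'k::field^'m"
  assumes "\<sigma> \<in> carrier G"
  shows "v \<in> tuple_space G g \<sigma> \<longleftrightarrow> (\<forall>i. v $ i \<noteq> 0 \<longrightarrow> g i = \<sigma>)"
proof -
  let ?S = "{axis i 1 | i. g i = \<sigma>} :: ('k^'m) set"
  let ?U = "{v :: 'k^'m. \<forall>i. v $ i \<noteq> 0 \<longrightarrow> g i = \<sigma>}"
  have "vec.subspace ?U"
    unfolding vec.subspace_def by auto (metis add.left_neutral)
  then have "vec.span ?S \<subseteq> ?U"
    by (rule vec.span_minimal[rotated]) (auto simp: axis_def split: if_splits)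
  moreover have "v \<in> vec.span ?S" if "v \<in> ?U" for v
  proof -
    have "v $ i *s axis i 1 \<in> vec.span ?S" for i
    proof (cases "v $ i = 0")
      case False
      then have "axis i 1 \<in> ?S" using that by blast
      then show ?thesis by (intro vec.span_scale vec.span_base)
    qed (simp add: vec.span_zero)
    then have "(\<Sum>i\<in>UNIV. v $ i *s axis i 1) \<in> vec.span ?S"
      by (intro vec.span_sum)
    then show ?thesis by (simp add: basis_expansion)
  qed
  ultimately show ?thesis
    using assms unfolding tuple_space_def by auto
qed

lemma matrix_vector_mult_axis_component:
  fixes A :: "'k::field^'n^'m"
  shows "(A *v axis j 1) $ i = A $ i $ j"
  by (simp add: matrix_vector_mult_def axis_def mult_delta_right)

text \<open>
  Column \<open>j\<close> of \<open>A\<close> is the image of the \<open>j\<close>-th basis vector, which has degree \<open>g j\<close>; the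
  endomorphism has degree \<open>\<sigma>\<close> exactly if all these columns are homogeneous of degree \<open>\<sigma> g\<^sub>j\<close>. This
  turns \<open>END\<close> into a condition on entries.
\<close>

lemma mem_tuple_grading_iff:
  fixes A :: "'k::field^'m^'m"
  assumes "group G" and g: "g \<in> tuples G" and \<sigma>: "\<sigma> \<in> carrier G"
  shows "A \<in> tuple_grading G g \<sigma> \<longleftrightarrow> (\<forall>i j. A $ i $ j \<noteq> 0 \<longrightarrow> g i \<otimes>\<^bsub>G\<^esub> inv\<^bsub>G\<^esub> (g j) = \<sigma>)"
proof -
  interpret group G by fact
  have gc: "g i \<in> carrier G" for i
    using g unfolding tuples_def by auto
  have deg: "g i \<otimes>\<^bsub>G\<^esub> inv\<^bsub>G\<^esub> (g j) = \<sigma> \<longleftrightarrow> g i = \<sigma> \<otimes>\<^bsub>G\<^esub> g j" for i j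
    using inv_solve_right[of \<sigma> "g i" "g j"] gc \<sigma> by metis
  have "A \<in> tuple_grading G g \<sigma> \<longleftrightarrow>
      (\<forall>\<tau>\<in>carrier G. \<forall>v\<in>tuple_space G g \<tau>. A *v v \<in> tuple_space G g (\<sigma> \<otimes>\<^bsub>G\<^esub> \<tau>))"
    using \<sigma> unfolding tuple_grading_def END_def by auto
  also have "\<dots> \<longleftrightarrow> (\<forall>i j. A $ i $ j \<noteq> 0 \<longrightarrow> g i = \<sigma> \<otimes>\<^bsub>G\<^esub> g j)"
  proof (intro iffI allI impI ballI)
    fix i j
    assume map: "\<forall>\<tau>\<in>carrier G. \<forall>v\<in>tuple_space G g \<tau>. A *v v \<in> tuple_space G g (\<sigma> \<otimes>\<^bsub>G\<^esub> \<tau>)"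
      and nz: "A $ i $ j \<noteq> 0"
    have "(axis j 1 :: 'k^'m) \<in> tuple_space G g (g j)"
      using gc by (auto simp: mem_tuple_space_iff axis_def)
    then have "A *v axis j 1 \<in> tuple_space G g (\<sigma> \<otimes>\<^bsub>G\<^esub> g j)"
      using map gc by blast
    then show "g i = \<sigma> \<otimes>\<^bsub>G\<^esub> g j"
      using nz gc \<sigma> by (simp add: mem_tuple_space_iff matrix_vector_mult_axis_component)
  next
    fix \<tau> and v :: "'k^'m"
    assume A: "\<forall>i j. A $ i $ j \<noteq> 0 \<longrightarrow> g i = \<sigma> \<otimes>\<^bsub>G\<^esub> g j"
      and \<tau>: "\<tau> \<in> carrier G" and v: "v \<in> tuple_space G g \<tau>"
    have "g i = \<sigma> \<otimes>\<^bsub>G\<^esub> \<tau>" if "(A *v v) $ i \<noteq> 0" for i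
    proof -
      have "(\<Sum>j\<in>UNIV. A $ i $ j * v $ j) \<noteq> 0"
        using that by (simp add: matrix_vector_mult_def)
      then obtain j where "A $ i $ j * v $ j \<noteq> 0"
        by (rule sum.not_neutral_contains_not_neutral)
      then show ?thesis
        using A v \<tau> by (auto simp: mem_tuple_space_iff)
    qed
    then show "A *v v \<in> tuple_space G g (\<sigma> \<otimes>\<^bsub>G\<^esub> \<tau>)"
      using \<sigma> \<tau> by (simp add: mem_tuple_space_iff)
  qed
  finally show ?thesis by (simp add: deg)
qed

lemma graded_tuple_space:
  assumes "g \<in> tuples G"
  shows "graded_space G (*s) (tuple_space G g :: 'g \<Rightarrow> ('k::field^'m) set)"
proof (rule graded_space_by_coordinates[where coord = "\<lambda>i v. v $ i" and d = g])
  show "\<exists>v :: 'k^'m. \<forall>i. v $ i = f i" for f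
    by (rule exI[of _ "\<chi> i. f i"]) simp
  show "tuple_space G g = (\<lambda>\<sigma>\<in>carrier G. {v :: 'k^'m. \<forall>i. v $ i \<noteq> 0 \<longrightarrow> g i = \<sigma>})"
  proof (rule extensionalityI)
    show "tuple_space G g \<in> extensional (carrier G)"
      unfolding tuple_space_def by simp
  qed (auto simp: mem_tuple_space_iff)
qed (use assms in \<open>auto simp: tuples_def vec_eq_iff vec.module_axioms\<close>)

lemma graded_tuple_grading:
  assumes "group G" and g: "g \<in> tuples G"
  shows "graded_space G mat_scale (tuple_grading G g :: 'g \<Rightarrow> ('k::field^'m^'m) set)"
proof -
  interpret group G by fact
  show ?thesis
  proof (rule graded_space_by_coordinates[where coord = "\<lambda>(i, j) A. A $ i $ j"
        and d = "\<lambda>(i, j). g i \<otimes>\<^bsub>G\<^esub> inv\<^bsub>G\<^esub> (g j)"])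
    show "\<exists>A :: 'k^'m^'m. \<forall>p. (case p of (i, j) \<Rightarrow> \<lambda>A. A $ i $ j) A = f p" for f
      by (rule exI[of _ "\<chi> i j. f (i, j)"]) auto
    show "tuple_grading G g = (\<lambda>\<sigma>\<in>carrier G. {A :: 'k^'m^'m. \<forall>p.
        (case p of (i, j) \<Rightarrow> \<lambda>A. A $ i $ j) A \<noteq> 0 \<longrightarrow>
        (case p of (i, j) \<Rightarrow> g i \<otimes>\<^bsub>G\<^esub> inv\<^bsub>G\<^esub> (g j)) = \<sigma>})"
    proof (rule extensionalityI)
      show "tuple_grading G g \<in> extensional (carrier G)"
        unfolding tuple_grading_def END_def by simp
    qed (auto simp: mem_tuple_grading_iff[OF assms])
    show "(case p of (i, j) \<Rightarrow> g i \<otimes>\<^bsub>G\<^esub> inv\<^bsub>G\<^esub> (g j)) \<in> carrier G" for p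
      using g by (auto simp: tuples_def split: prod.split)
  qed (auto simp: vec_eq_iff mat_scale_def mat.module_axioms)
qed

lemma matrix_unit_mult:
  "(matrix_unit i j :: 'k::field^'m^'m) ** matrix_unit k l = (if j = k then matrix_unit i l else 0)"
proof -
  have "(\<Sum>c\<in>UNIV. (if a = i \<and> c = j then 1 else 0) * (if c = k \<and> b = l then 1 else 0)) =
      (\<Sum>c\<in>UNIV. if c = j then (if a = i \<and> j = k \<and> b = l then 1 else 0) else (0 :: 'k))" for a b
    by (intro sum.cong) auto
  then show ?thesis
    unfolding matrix_unit_def matrix_matrix_mult_def vec_eq_iff by simp
qed

lemma matrix_unit_neq_zero: "(matrix_unit i j :: 'k::field^'m^'m) \<noteq> 0"
  by (auto simp: matrix_unit_def vec_eq_iff)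

lemma matrix_unit_expansion:
  "(A :: 'k::field^'m^'m) = (\<Sum>i\<in>UNIV. \<Sum>j\<in>UNIV. mat_scale (A $ i $ j) (matrix_unit i j))"
proof -
  have "(\<Sum>i\<in>UNIV. \<Sum>j\<in>UNIV. A $ i $ j * (if a = i \<and> b = j then 1 else 0)) = A $ a $ b" for a b
  proof -
    have "(\<Sum>i\<in>UNIV. \<Sum>j\<in>UNIV. A $ i $ j * (if a = i \<and> b = j then 1 else 0)) =
        (\<Sum>i\<in>UNIV. if a = i then A $ i $ b else 0)"
      by (intro sum.cong) (auto simp: mult_delta_right)
    then show ?thesis by simp
  qed
  then show ?thesis
    by (simp only: vec_eq_iff sum_component mat_scale_def matrix_unit_def vec_lambda_beta simp_thms)
qed

lemma matrix_unit_mem_tuple_grading: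
  assumes "group G" and g: "g \<in> tuples G"
  shows "matrix_unit i j \<in> tuple_grading G g (g i \<otimes>\<^bsub>G\<^esub> inv\<^bsub>G\<^esub> (g j))"
proof -
  interpret group G by fact
  have "g i \<otimes>\<^bsub>G\<^esub> inv\<^bsub>G\<^esub> (g j) \<in> carrier G"
    using g by (auto simp: tuples_def)
  then show ?thesis
    by (auto simp: mem_tuple_grading_iff[OF assms] matrix_unit_def)
qed

lemma tuple_grading_good:
  assumes "group G" and g: "g \<in> tuples G"
  shows "(tuple_grading G g :: 'g \<Rightarrow> ('k::field^'m^'m) set) \<in> good_gradings G"
proof -
  interpret group G by fact
  have gc: "g i \<in> carrier G" for i
    using g by (auto simp: tuples_def)
  have "A ** B \<in> tuple_grading G g (\<sigma> \<otimes>\<^bsub>G\<^esub> \<tau>)"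
    if "\<sigma> \<in> carrier G" "\<tau> \<in> carrier G" "A \<in> tuple_grading G g \<sigma>" "B \<in> tuple_grading G g \<tau>"
    for \<sigma> \<tau> and A B :: "'k^'m^'m"
    using that unfolding tuple_grading_def END_def
    by (auto simp: image_subset_iff m_assoc simp flip: matrix_vector_mul_assoc)
  moreover have "\<exists>\<sigma>\<in>carrier G. matrix_unit i j \<in> tuple_grading G g \<sigma>" for i j
    using matrix_unit_mem_tuple_grading[OF assms, of i j] gc by blast
  ultimately show ?thesis
    using graded_tuple_grading[OF assms] unfolding good_gradings_def matrix_grading_def by blast
qed

text \<open>
  The degrees of the matrix units determine a good grading: its component of degree \<open>\<sigma>\<close> contains
  the span of the matrix units of degree \<open>\<sigma>\<close>, and these spans already form a grading.
\<close>

lemma tuple_grading_eqI: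
  fixes \<A> :: "'g \<Rightarrow> ('k::field^'m^'m) set"
  assumes "group G" and g: "g \<in> tuples G" and good: "\<A> \<in> good_gradings G"
    and units: "\<And>i j. matrix_unit i j \<in> \<A> (g i \<otimes>\<^bsub>G\<^esub> inv\<^bsub>G\<^esub> (g j))"
  shows "\<A> = tuple_grading G g"
proof -
  have gr: "graded_space G mat_scale \<A>"
    using good unfolding good_gradings_def matrix_grading_def by blast
  have "tuple_grading G g = \<A>"
  proof (rule graded_space_eqI[OF mat.module_axioms graded_tuple_grading[OF assms(1,2)] gr], rule)
    fix \<sigma> and A :: "'k^'m^'m"
    assume \<sigma>: "\<sigma> \<in> carrier G" and A: "A \<in> tuple_grading G g \<sigma>"
    note sub = graded_space_subspace[OF gr \<sigma>]
    have "mat_scale (A $ i $ j) (matrix_unit i j) \<in> \<A> \<sigma>" for i j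
    proof (cases "A $ i $ j = 0")
      case True
      then show ?thesis using mat.subspace_0[OF sub] by simp
    next
      case False
      then have "g i \<otimes>\<^bsub>G\<^esub> inv\<^bsub>G\<^esub> (g j) = \<sigma>"
        using A by (simp add: mem_tuple_grading_iff[OF assms(1,2) \<sigma>])
      then show ?thesis
        using mat.subspace_scale[OF sub] units[of i j] by simp
    qed
    then have "(\<Sum>i\<in>UNIV. \<Sum>j\<in>UNIV. mat_scale (A $ i $ j) (matrix_unit i j)) \<in> \<A> \<sigma>"
      by (intro mat.subspace_sum[OF sub])
    then show "A \<in> \<A> \<sigma>"
      using matrix_unit_expansion[of A] by simp
  qed
  then show ?thesis ..
qed

text \<open>
  The degrees of the matrix units form a cocycle \<open>d i j\<close>, trivialised by its column at an
  arbitrary index \<open>r\<close>.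
\<close>

lemma good_grading_is_tuple_grading:
  fixes \<A> :: "'g \<Rightarrow> ('k::field^'m^'m) set"
  assumes "group G" and good: "\<A> \<in> good_gradings G"
  obtains g where "g \<in> tuples G" and "\<A> = tuple_grading G g"
proof -
  interpret group G by fact
  have gr: "graded_space G mat_scale \<A>"
    and mult: "\<And>\<sigma> \<tau> A B. \<lbrakk>\<sigma> \<in> carrier G; \<tau> \<in> carrier G; A \<in> \<A> \<sigma>; B \<in> \<A> \<tau>\<rbrakk>
      \<Longrightarrow> A ** B \<in> \<A> (\<sigma> \<otimes>\<^bsub>G\<^esub> \<tau>)"
    and "\<forall>i j. \<exists>\<sigma>. \<sigma> \<in> carrier G \<and> matrix_unit i j \<in> \<A> \<sigma>"
    using good unfolding good_gradings_def matrix_grading_def by blast+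
  then obtain d where dc: "\<And>i j. d i j \<in> carrier G"
    and d: "\<And>i j. matrix_unit i j \<in> \<A> (d i j)"
    by metis
  have cocycle: "d i j \<otimes>\<^bsub>G\<^esub> d j l = d i l" for i j l
  proof (rule graded_space_degree_unique[OF mat.module_axioms gr])
    show "matrix_unit i l \<in> \<A> (d i j \<otimes>\<^bsub>G\<^esub> d j l)"
      using mult[OF dc dc d d, of i j j l] by (simp add: matrix_unit_mult)
  qed (simp_all add: dc d matrix_unit_neq_zero)
  fix r :: 'm
  have diag: "d i i = \<one>\<^bsub>G\<^esub>" for i
    using cocycle[of i i i] dc r_cancel_one by blast
  have inv: "inv\<^bsub>G\<^esub> (d i r) = d r i" for i
    using inv_equality[of "d r i" "d i r"] cocycle[of r i r] diag dc by simp
  have "(\<lambda>i. d i r) \<in> tuples G"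
    using dc by (simp add: tuples_def)
  moreover have "\<A> = tuple_grading G (\<lambda>i. d i r)"
    using tuple_grading_eqI[OF assms(1) calculation good] d by (simp add: inv cocycle)
  ultimately show ?thesis by (rule that)
qed

section \<open>Isomorphic gradings come from the same orbit\<close>

text \<open>
  The images \<open>f i j\<close> of the matrix units move a single homogeneous vector to a homogeneous basis
  \<open>w\<close> of the space of column vectors. This basis has degrees \<open>g i \<otimes> \<rho>\<close>, whereas the standard basis has
  degrees \<open>h a\<close>; the determinant of the change of basis matches the two lists of degrees.
\<close>

lemma tuple_grading_hom_imp_permuted:
  fixes \<phi> :: "'k::field^'m^'m \<Rightarrow> 'k^'m^'m"
  assumes "group G" and g: "g \<in> tuples G" and h: "h \<in> tuples G"
    and inj: "inj \<phi>" and zero: "\<phi> 0 = 0" and mult: "\<And>A B. \<phi> (A ** B) = \<phi> A ** \<phi> B"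
    and deg: "\<And>\<sigma>. \<sigma> \<in> carrier G \<Longrightarrow> \<phi> ` tuple_grading G g \<sigma> \<subseteq> tuple_grading G h \<sigma>"
  obtains \<sigma> \<pi> where "\<sigma> \<in> carrier G" and "\<pi> permutes UNIV" and "\<And>i. h i = g (\<pi> i) \<otimes>\<^bsub>G\<^esub> \<sigma>"
proof -
  interpret group G by fact
  have gc: "g i \<in> carrier G" and hc: "h i \<in> carrier G" for i
    using g h by (auto simp: tuples_def)
  define f where "f i j = \<phi> (matrix_unit i j)" for i j
  have f_mult: "f i j ** f k l = (if j = k then f i l else 0)" for i j k l
    unfolding f_def by (simp add: matrix_unit_mult zero flip: mult)
  have f_deg: "f i j \<in> tuple_grading G h (g i \<otimes>\<^bsub>G\<^esub> inv\<^bsub>G\<^esub> (g j))" for i j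
    using deg[of "g i \<otimes>\<^bsub>G\<^esub> inv\<^bsub>G\<^esub> (g j)"] matrix_unit_mem_tuple_grading[OF assms(1) g] gc
    unfolding f_def by blast
  fix r :: 'm
  have "f r r \<noteq> 0"
    using inj zero matrix_unit_neq_zero unfolding f_def by (metis injD)
  then obtain q p where qp: "f r r $ q $ p \<noteq> 0"
    by (auto simp: vec_eq_iff)
  define w where "w i = f i r *v axis p 1" for i
  \<comment> \<open>The basis vector at \<open>p\<close> has degree \<open>h p\<close> and \<open>f i r\<close> has degree \<open>g i \<otimes> inv (g r)\<close>, so
      \<open>w i\<close> has degree \<open>g i \<otimes> \<rho>\<close> for this \<open>\<rho>\<close>.\<close>
  define \<rho> where "\<rho> = inv\<^bsub>G\<^esub> (g r) \<otimes>\<^bsub>G\<^esub> h p"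
  have \<rho>: "\<rho> \<in> carrier G"
    using gc hc unfolding \<rho>_def by simp
  have w_deg: "h a = g i \<otimes>\<^bsub>G\<^esub> \<rho>" if "w i $ a \<noteq> 0" for i a
  proof -
    have "f i r $ a $ p \<noteq> 0"
      using that by (simp add: w_def matrix_vector_mult_axis_component)
    then have "h a \<otimes>\<^bsub>G\<^esub> inv\<^bsub>G\<^esub> (h p) = g i \<otimes>\<^bsub>G\<^esub> inv\<^bsub>G\<^esub> (g r)"
      using f_deg[of i r] gc by (simp add: mem_tuple_grading_iff[OF assms(1) h])
    then have "h a = g i \<otimes>\<^bsub>G\<^esub> inv\<^bsub>G\<^esub> (g r) \<otimes>\<^bsub>G\<^esub> h p"
      using inv_solve_right[of "g i \<otimes>\<^bsub>G\<^esub> inv\<^bsub>G\<^esub> (g r)" "h a" "h p"] gc hc by simp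
    then show ?thesis
      using gc hc by (simp add: \<rho>_def m_assoc)
  qed
  have pick: "f r i *v w l = (if i = l then w r else 0)" for i l
    unfolding w_def by (simp add: matrix_vector_mul_assoc f_mult)
  have wq: "w r $ q \<noteq> 0"
    using qp by (simp add: w_def matrix_vector_mult_axis_component)
  \<comment> \<open>The vectors \<open>w i\<close> are the columns of \<open>W\<close>. Since \<open>f r i\<close> sends \<open>w i\<close> to \<open>w r\<close> and
      kills the other \<open>w l\<close>, its row at a nonzero entry \<open>q\<close> of \<open>w r\<close> is, up to a scalar, row \<open>i\<close> of
      a left inverse \<open>U\<close>.\<close>
  define W where "W = (\<chi> a i. w i $ a)"
  define U where "U = (\<chi> i a. f r i $ q $ a / w r $ q)"
  have "(U ** W) $ i $ l = (mat 1 :: 'k^'m^'m) $ i $ l" for i l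
  proof -
    have "(U ** W) $ i $ l = (f r i *v w l) $ q / w r $ q"
      by (simp add: U_def W_def matrix_matrix_mult_def matrix_vector_mult_def sum_divide_distrib)
    then show ?thesis
      using wq by (simp add: pick mat_def)
  qed
  then have "U ** W = mat 1"
    by (simp add: vec_eq_iff)
  then have "det U * det W = 1"
    by (metis det_mul det_I)
  then have "det W \<noteq> 0" by auto
  \<comment> \<open>Some summand of the Leibniz formula survives, hence so does each of its factors.\<close>
  then obtain \<pi> where \<pi>: "\<pi> permutes UNIV"
    and nz: "of_int (sign \<pi>) * (\<Prod>a\<in>UNIV. W $ a $ \<pi> a) \<noteq> 0"
    unfolding det_def by (rule sum.not_neutral_contains_not_neutral) blast
  have "W $ a $ \<pi> a \<noteq> 0" for a
    using nz by (auto simp: prod_zero_iff)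
  then have "h a = g (\<pi> a) \<otimes>\<^bsub>G\<^esub> \<rho>" for a
    using w_deg[of "\<pi> a" a] by (simp add: W_def)
  then show ?thesis
    using that[OF \<rho> \<pi>] by blast
qed

text \<open>
  Simultaneous permutation of rows and columns, which is conjugation by a permutation matrix,
  carries one grading to the other; the translation by \<open>\<sigma>\<close> cancels in \<open>h i \<otimes> inv (h j)\<close>.
\<close>

lemma permuted_translated_imp_iso:
  assumes "group G" and g: "g \<in> tuples G" and h: "h \<in> tuples G"
    and \<sigma>: "\<sigma> \<in> carrier G" and \<pi>: "\<pi> permutes UNIV"
    and hg: "\<And>i. h i = g (\<pi> i) \<otimes>\<^bsub>G\<^esub> \<sigma>"
  shows "(tuple_grading G g :: 'g \<Rightarrow> ('k::field^'m^'m) set, tuple_grading G h) \<in> good_grading_iso G"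
proof -
  interpret group G by fact
  have gc: "g i \<in> carrier G" for i
    using g by (auto simp: tuples_def)
  define \<phi> :: "'k^'m^'m \<Rightarrow> 'k^'m^'m" where "\<phi> A = (\<chi> i j. A $ \<pi> i $ \<pi> j)" for A
  have \<pi>_bij: "bij \<pi>" using \<pi> by (rule permutes_bij)
  have right_inv: "\<phi> (\<chi> i j. B $ inv_into UNIV \<pi> i $ inv_into UNIV \<pi> j) = B" for B :: "'k^'m^'m"
    using \<pi>_bij by (simp add: \<phi>_def vec_eq_iff bij_is_inj)
  have left_inv: "(\<chi> i j. \<phi> B $ inv_into UNIV \<pi> i $ inv_into UNIV \<pi> j) = B" for B :: "'k^'m^'m"
    using \<pi>_bij by (simp add: \<phi>_def vec_eq_iff bij_is_surj surj_f_inv_f)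
  have "bij \<phi>"
    by (rule o_bij[where g = "\<lambda>B. \<chi> i j. B $ inv_into UNIV \<pi> i $ inv_into UNIV \<pi> j"])
      (simp_all add: fun_eq_iff right_inv left_inv)
  moreover have "Vector_Spaces.linear mat_scale mat_scale \<phi>"
    unfolding Vector_Spaces.linear_iff
    by (simp add: \<phi>_def vec_eq_iff mat_scale_def mat.vector_space_axioms)
  moreover have "\<phi> (mat 1) = mat 1"
    using \<pi>_bij by (simp add: \<phi>_def vec_eq_iff mat_def bij_is_inj inj_eq)
  moreover have "\<phi> (A ** B) = \<phi> A ** \<phi> B" for A B :: "'k^'m^'m"
    using sum.reindex_bij_betw[OF \<pi>_bij, of "\<lambda>k. A $ _ $ k * B $ k $ _"]
    by (simp add: \<phi>_def vec_eq_iff matrix_matrix_mult_def)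
  moreover have "\<phi> ` tuple_grading G g \<tau> = tuple_grading G h \<tau>" if \<tau>: "\<tau> \<in> carrier G" for \<tau>
  proof -
    have hdeg: "h i \<otimes>\<^bsub>G\<^esub> inv\<^bsub>G\<^esub> (h j) = g (\<pi> i) \<otimes>\<^bsub>G\<^esub> inv\<^bsub>G\<^esub> (g (\<pi> j))" for i j
      using gc \<sigma> by (simp add: hg inv_mult_group m_assoc inv_solve_left)
        (simp flip: m_assoc)
    have mem: "\<phi> A \<in> tuple_grading G h \<tau> \<longleftrightarrow> A \<in> tuple_grading G g \<tau>" for A :: "'k^'m^'m"
    proof -
      have "(\<forall>i j. A $ \<pi> i $ \<pi> j \<noteq> 0 \<longrightarrow> g (\<pi> i) \<otimes>\<^bsub>G\<^esub> inv\<^bsub>G\<^esub> (g (\<pi> j)) = \<tau>) \<longleftrightarrow>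
          (\<forall>i j. A $ i $ j \<noteq> 0 \<longrightarrow> g i \<otimes>\<^bsub>G\<^esub> inv\<^bsub>G\<^esub> (g j) = \<tau>)"
        using \<pi>_bij by (metis bij_pointE)
      then show ?thesis
        by (simp add: mem_tuple_grading_iff[OF assms(1) g \<tau>] mem_tuple_grading_iff[OF assms(1) h \<tau>]
            \<phi>_def hdeg)
    qed
    show ?thesis
    proof (intro equalityI subsetI)
      fix B :: "'k^'m^'m" assume "B \<in> tuple_grading G h \<tau>"
      then show "B \<in> \<phi> ` tuple_grading G g \<tau>"
        by (intro image_eqI[where x = "\<chi> i j. B $ inv_into UNIV \<pi> i $ inv_into UNIV \<pi> j"])
          (simp_all add: right_inv flip: mem)
    qed (auto simp: mem)
  qed
  ultimately have "\<exists>\<phi> :: 'k^'m^'m \<Rightarrow> 'k^'m^'m. matrix_algebra_iso \<phi> \<and>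
      (\<forall>\<tau>\<in>carrier G. \<phi> ` tuple_grading G g \<tau> = tuple_grading G h \<tau>)"
    unfolding matrix_algebra_iso_def by blast
  then show ?thesis
    using tuple_grading_good[OF assms(1) g] tuple_grading_good[OF assms(1) h]
    unfolding good_grading_iso_def by blast
qed

section \<open>Orbits\<close>

text \<open>
  The action is written with the inverse of the permutation; as permutations are closed under
  inversion, the inverse may be dropped when describing an orbit.
\<close>

lemma mem_tuple_orbit_iff:
  "h \<in> tuple_orbit G g \<longleftrightarrow>
     (\<exists>\<sigma>\<in>carrier G. \<exists>\<pi>. \<pi> permutes UNIV \<and> (\<forall>i. h i = g (\<pi> i) \<otimes>\<^bsub>G\<^esub> \<sigma>))"
proof
  assume "h \<in> tuple_orbit G g"
  then show "\<exists>\<sigma>\<in>carrier G. \<exists>\<pi>. \<pi> permutes UNIV \<and> (\<forall>i. h i = g (\<pi> i) \<otimes>\<^bsub>G\<^esub> \<sigma>)"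
    unfolding tuple_orbit_def translate_def permute_entries_def
    using permutes_inv by fastforce
next
  assume "\<exists>\<sigma>\<in>carrier G. \<exists>\<pi>. \<pi> permutes UNIV \<and> (\<forall>i. h i = g (\<pi> i) \<otimes>\<^bsub>G\<^esub> \<sigma>)"
  then obtain \<sigma> \<pi> where "\<sigma> \<in> carrier G" and \<pi>: "\<pi> permutes UNIV"
    and "\<forall>i. h i = g (\<pi> i) \<otimes>\<^bsub>G\<^esub> \<sigma>" by blast
  then have "h = translate G (permute_entries (inv_into UNIV \<pi>) g) \<sigma>"
    by (simp add: fun_eq_iff translate_def permute_entries_def permutes_inv_inv)
  then show "h \<in> tuple_orbit G g"
    using permutes_inv[OF \<pi>] \<open>\<sigma> \<in> carrier G\<close> unfolding tuple_orbit_def by blast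
qed

lemma tuple_orbit_refl:
  assumes "group G" and "g \<in> tuples G"
  shows "g \<in> tuple_orbit G g"
proof -
  interpret group G by fact
  show ?thesis
    unfolding mem_tuple_orbit_iff using assms(2) permutes_id
    by (intro bexI[of _ "\<one>\<^bsub>G\<^esub>"] exI[of _ id]) (auto simp: tuples_def Pi_iff)
qed

lemma tuple_orbit_mono:
  assumes "group G" and g: "g \<in> tuples G" and h: "h \<in> tuple_orbit G g"
  shows "tuple_orbit G h \<subseteq> tuple_orbit G g"
proof
  interpret group G by fact
  fix l assume "l \<in> tuple_orbit G h"
  then obtain \<sigma> \<pi> where l: "\<sigma> \<in> carrier G" "\<pi> permutes UNIV" "\<And>i. l i = h (\<pi> i) \<otimes>\<^bsub>G\<^esub> \<sigma>"
    unfolding mem_tuple_orbit_iff by blast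
  obtain \<tau> \<rho> where h: "\<tau> \<in> carrier G" "\<rho> permutes UNIV" "\<And>i. h i = g (\<rho> i) \<otimes>\<^bsub>G\<^esub> \<tau>"
    using h unfolding mem_tuple_orbit_iff by blast
  have "l i = g ((\<rho> \<circ> \<pi>) i) \<otimes>\<^bsub>G\<^esub> (\<tau> \<otimes>\<^bsub>G\<^esub> \<sigma>)" for i
    using l h g by (auto simp: tuples_def Pi_iff m_assoc)
  then show "l \<in> tuple_orbit G g"
    unfolding mem_tuple_orbit_iff using l h permutes_compose[OF l(2) h(2)] by blast
qed

lemma tuple_orbit_sym:
  assumes "group G" and g: "g \<in> tuples G" and h: "h \<in> tuple_orbit G g"
  shows "g \<in> tuple_orbit G h"
proof -
  interpret group G by fact
  obtain \<tau> \<rho> where h: "\<tau> \<in> carrier G" "\<rho> permutes UNIV" "\<And>i. h i = g (\<rho> i) \<otimes>\<^bsub>G\<^esub> \<tau>"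
    using h unfolding mem_tuple_orbit_iff by blast
  have "g i = h (inv_into UNIV \<rho> i) \<otimes>\<^bsub>G\<^esub> inv\<^bsub>G\<^esub> \<tau>" for i
    using h g by (simp add: tuples_def Pi_iff m_assoc permutes_inverses)
  then show ?thesis
    unfolding mem_tuple_orbit_iff using permutes_inv[OF h(2)] h(1) by blast
qed

lemma tuple_orbit_eq_iff_mem:
  assumes "group G" and "g \<in> tuples G" and "h \<in> tuples G"
  shows "tuple_orbit G g = tuple_orbit G h \<longleftrightarrow> h \<in> tuple_orbit G g"
proof
  show "h \<in> tuple_orbit G g" if "tuple_orbit G g = tuple_orbit G h"
    using tuple_orbit_refl[OF assms(1,3)] that by simp
  show "tuple_orbit G g = tuple_orbit G h" if "h \<in> tuple_orbit G g"
    using tuple_orbit_mono[OF assms(1,2) that]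
      tuple_orbit_mono[OF assms(1,3) tuple_orbit_sym[OF assms(1,2) that]] by blast
qed

lemma tuple_grading_iso_iff:
  assumes "group G" and g: "g \<in> tuples G" and h: "h \<in> tuples G"
  shows "(tuple_grading G g :: 'g \<Rightarrow> ('k::field^'m^'m) set, tuple_grading G h) \<in> good_grading_iso G
    \<longleftrightarrow> tuple_orbit G g = tuple_orbit G h"
proof
  assume "(tuple_grading G g :: 'g \<Rightarrow> ('k^'m^'m) set, tuple_grading G h) \<in> good_grading_iso G"
  then obtain \<phi> :: "'k^'m^'m \<Rightarrow> 'k^'m^'m" where iso: "matrix_algebra_iso \<phi>"
    and deg: "\<And>\<sigma>. \<sigma> \<in> carrier G \<Longrightarrow> \<phi> ` tuple_grading G g \<sigma> = tuple_grading G h \<sigma>"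
    unfolding good_grading_iso_def by blast
  have "\<phi> (0 + 0) = \<phi> 0 + \<phi> 0"
    using iso unfolding matrix_algebra_iso_def Vector_Spaces.linear_iff by blast
  then have "\<phi> 0 = 0" by simp
  then obtain \<sigma> \<pi> where "\<sigma> \<in> carrier G" "\<pi> permutes UNIV" "\<And>i. h i = g (\<pi> i) \<otimes>\<^bsub>G\<^esub> \<sigma>"
    using tuple_grading_hom_imp_permuted[OF assms, of \<phi>] iso deg
    unfolding matrix_algebra_iso_def by (metis bij_is_inj order_refl)
  then show "tuple_orbit G g = tuple_orbit G h"
    unfolding tuple_orbit_eq_iff_mem[OF assms] mem_tuple_orbit_iff by blast
next
  assume "tuple_orbit G g = tuple_orbit G h"
  then show "(tuple_grading G g :: 'g \<Rightarrow> ('k^'m^'m) set, tuple_grading G h) \<in> good_grading_iso G"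
    unfolding tuple_orbit_eq_iff_mem[OF assms] mem_tuple_orbit_iff
    using permuted_translated_imp_iso[OF assms] by blast
qed

section \<open>The classification\<close>

text \<open>
  Every good grading comes from a tuple, so symmetry and transitivity are inherited from equality
  of orbits.
\<close>

lemma equiv_good_grading_iso:
  assumes "group G"
  shows "equiv (good_gradings G)
    (good_grading_iso G :: (('g \<Rightarrow> ('k::field^'m^'m) set) \<times> ('g \<Rightarrow> ('k^'m^'m) set)) set)"
    (is "equiv ?A ?R")
proof (rule equivI)
  show "?R \<subseteq> ?A \<times> ?A"
    unfolding good_grading_iso_def by blast
  have tuples: "\<exists>g\<in>tuples G. \<exists>h\<in>tuples G. \<A> = tuple_grading G g \<and> \<B> = tuple_grading G h"
    if R: "(\<A>, \<B>) \<in> ?R" for \<A> \<B>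
  proof -
    have "\<A> \<in> ?A" "\<B> \<in> ?A"
      using R unfolding good_grading_iso_def by blast+
    then obtain g h :: "'m \<Rightarrow> 'g" where "g \<in> tuples G" "\<A> = tuple_grading G g"
      and "h \<in> tuples G" "\<B> = tuple_grading G h"
      using good_grading_is_tuple_grading[OF assms] by metis
    then show ?thesis by blast
  qed
  show "refl_on ?A ?R"
  proof (rule refl_onI)
    fix \<A> :: "'g \<Rightarrow> ('k^'m^'m) set" assume "\<A> \<in> ?A"
    then obtain g :: "'m \<Rightarrow> 'g" where "g \<in> tuples G" and "\<A> = tuple_grading G g"
      by (rule good_grading_is_tuple_grading[OF assms])
    then show "(\<A>, \<A>) \<in> ?R"
      by (simp add: tuple_grading_iso_iff[OF assms])
  qed
  show "sym ?R"
  proof (rule symI)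
    fix \<A> \<B> assume R: "(\<A>, \<B>) \<in> ?R"
    with tuples obtain g h where "g \<in> tuples G" "h \<in> tuples G"
      and "\<A> = tuple_grading G g" "\<B> = tuple_grading G h" by blast
    then show "(\<B>, \<A>) \<in> ?R"
      using R by (simp add: tuple_grading_iso_iff[OF assms])
  qed
  show "trans ?R"
  proof (rule transI)
    fix \<A> \<B> \<C> assume R: "(\<A>, \<B>) \<in> ?R" "(\<B>, \<C>) \<in> ?R"
    obtain g h where g: "g \<in> tuples G" "\<A> = tuple_grading G g"
      and h: "h \<in> tuples G" "\<B> = tuple_grading G h"
      using tuples[OF R(1)] by blast
    obtain l where l: "l \<in> tuples G" "\<C> = tuple_grading G l"
      using tuples[OF R(2)] by blast
    show "(\<A>, \<C>) \<in> ?R"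
      using R g h l by (simp add: tuple_grading_iso_iff[OF assms])
  qed
qed

theorem corollary3p2:
  fixes G :: "('g, 'x) monoid_scheme"
  assumes "group G"
  shows
    "(\<forall>g\<in>tuples G.
        graded_space G (*s) (tuple_space G g :: 'g \<Rightarrow> ('k::field^'m) set) \<and>
        (\<forall>i. axis i 1 \<in> (tuple_space G g (g i) :: ('k^'m) set)) \<and>
        (\<forall>\<A> :: 'g \<Rightarrow> ('k^'m^'m) set.
           \<A> = tuple_grading G g \<longleftrightarrow>
           \<A> \<in> good_gradings G \<and>
           (\<forall>i j. matrix_unit i j \<in> \<A> (g i \<otimes>\<^bsub>G\<^esub> inv\<^bsub>G\<^esub> (g j))))) \<and>
     (\<forall>g\<in>tuples G. \<forall>h\<in>tuples G.
        tuple_orbit G g = tuple_orbit G (h :: 'm \<Rightarrow> 'g) \<longleftrightarrow>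
        (\<exists>\<sigma>\<in>carrier G. \<exists>\<pi>. \<pi> permutes UNIV \<and> (\<forall>i. h i = g (\<pi> i) \<otimes>\<^bsub>G\<^esub> \<sigma>))) \<and>
     equiv (good_gradings G)
       (good_grading_iso G :: (('g \<Rightarrow> ('k^'m^'m) set) \<times> ('g \<Rightarrow> ('k^'m^'m) set)) set) \<and>
     (\<exists>\<Phi>. bij_betw \<Phi>
            (tuple_orbit G ` (tuples G :: ('m \<Rightarrow> 'g) set))
            ((good_gradings G :: ('g \<Rightarrow> ('k^'m^'m) set) set) // good_grading_iso G) \<and>
          (\<forall>g\<in>tuples G. \<Phi> (tuple_orbit G g) = good_grading_iso G `` {tuple_grading G g}))"
proof -
  let ?T = "\<lambda>g :: 'm \<Rightarrow> 'g. tuple_grading G g :: 'g \<Rightarrow> ('k^'m^'m) set"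
  let ?R = "good_grading_iso G :: (('g \<Rightarrow> ('k^'m^'m) set) \<times> ('g \<Rightarrow> ('k^'m^'m) set)) set"
  let ?A = "good_gradings G :: ('g \<Rightarrow> ('k^'m^'m) set) set"
  have space: "graded_space G (*s) (tuple_space G g :: 'g \<Rightarrow> ('k^'m) set) \<and>
      (\<forall>i. axis i 1 \<in> (tuple_space G g (g i) :: ('k^'m) set)) \<and>
      (\<forall>\<A> :: 'g \<Rightarrow> ('k^'m^'m) set. \<A> = tuple_grading G g \<longleftrightarrow>
         \<A> \<in> good_gradings G \<and> (\<forall>i j. matrix_unit i j \<in> \<A> (g i \<otimes>\<^bsub>G\<^esub> inv\<^bsub>G\<^esub> (g j))))"
    if g: "g \<in> tuples G" for g :: "'m \<Rightarrow> 'g"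
  proof (intro conjI allI)
    show "graded_space G (*s) (tuple_space G g :: 'g \<Rightarrow> ('k^'m) set)"
      using g by (rule graded_tuple_space)
    fix i
    have "g i \<in> carrier G" using g by (auto simp: tuples_def)
    then show "axis i 1 \<in> (tuple_space G g (g i) :: ('k^'m) set)"
      by (auto simp: mem_tuple_space_iff axis_def)
  next
    fix \<A> :: "'g \<Rightarrow> ('k^'m^'m) set"
    show "\<A> = tuple_grading G g \<longleftrightarrow>
        \<A> \<in> good_gradings G \<and> (\<forall>i j. matrix_unit i j \<in> \<A> (g i \<otimes>\<^bsub>G\<^esub> inv\<^bsub>G\<^esub> (g j)))"
      using tuple_grading_eqI[OF assms g] tuple_grading_good[OF assms g]
        matrix_unit_mem_tuple_grading[OF assms g] by blast
  qed
  have orbit: "tuple_orbit G g = tuple_orbit G h \<longleftrightarrow>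
      (\<exists>\<sigma>\<in>carrier G. \<exists>\<pi>. \<pi> permutes UNIV \<and> (\<forall>i. h i = g (\<pi> i) \<otimes>\<^bsub>G\<^esub> \<sigma>))"
    if "g \<in> tuples G" "h \<in> tuples G" for g h :: "'m \<Rightarrow> 'g"
    using tuple_orbit_eq_iff_mem[OF assms that] by (simp add: mem_tuple_orbit_iff)
  have equiv: "equiv ?A ?R"
    using assms by (rule equiv_good_grading_iso)
  have class_eq: "?R `` {?T g} = ?R `` {?T h} \<longleftrightarrow> tuple_orbit G g = tuple_orbit G h"
    if "g \<in> tuples G" "h \<in> tuples G" for g h
    using eq_equiv_class_iff[OF equiv] that tuple_grading_good[OF assms]
      tuple_grading_iso_iff[OF assms that] by blast
  \<comment> \<open>\<open>class_eq\<close> makes \<open>\<Phi>\<close> independent of the chosen representative and injective; surjectivity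
      is \<open>good_grading_is_tuple_grading\<close>.\<close>
  define \<Phi> where
    "\<Phi> Q = ?R `` {?T (SOME g. g \<in> tuples G \<and> tuple_orbit G g = Q)}" for Q
  have \<Phi>: "\<Phi> (tuple_orbit G g) = ?R `` {?T g}" if g: "g \<in> tuples G" for g
  proof -
    let ?g = "SOME g'. g' \<in> tuples G \<and> tuple_orbit G g' = tuple_orbit G g"
    have "?g \<in> tuples G \<and> tuple_orbit G ?g = tuple_orbit G g"
      by (rule someI[of _ g]) (use g in simp)
    then show ?thesis
      unfolding \<Phi>_def using class_eq g by blast
  qed
  have "inj_on \<Phi> (tuple_orbit G ` tuples G)"
    using class_eq by (auto simp: inj_on_def \<Phi>)
  moreover have "\<Phi> ` tuple_orbit G ` tuples G = ?A // ?R"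
  proof (intro equalityI subsetI)
    fix C assume "C \<in> ?A // ?R"
    then obtain \<A> where "\<A> \<in> ?A" and C: "C = ?R `` {\<A>}"
      by (rule quotientE)
    then obtain g :: "'m \<Rightarrow> 'g" where g: "g \<in> tuples G" and "\<A> = ?T g"
      using good_grading_is_tuple_grading[OF assms] by blast
    then have "C = \<Phi> (tuple_orbit G g)"
      using C \<Phi> by simp
    then show "C \<in> \<Phi> ` tuple_orbit G ` tuples G"
      using g by blast
  qed (use tuple_grading_good[OF assms] in \<open>auto simp: \<Phi> intro!: quotientI\<close>)
  ultimately have "bij_betw \<Phi> (tuple_orbit G ` tuples G) (?A // ?R)"
    unfolding bij_betw_def by blast
  with \<Phi> have bij: "\<exists>\<Phi>. bij_betw \<Phi> (tuple_orbit G ` tuples G) (?A // ?R) \<and>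
      (\<forall>g\<in>tuples G. \<Phi> (tuple_orbit G g) = ?R `` {?T g})"
    by blast
  show ?thesis
    by (rule conjI[OF ballI[OF space]
          conjI[OF ballI[OF ballI[OF orbit]] conjI[OF equiv bij]]])
qed

end
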